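(* Let $a,b\in\mathbb{R}$, $a<b$, and let $\rho:[a,b]\to\mathbb{R}$ be a continuous function. Let $I:[a,b]\times[a,b]\to\mathbb{R}$ be a function in two variables satisfying the following two axioms: (A) $I(x,y)+I(y,z)=I(x,z)$ for all $x,y,z\in[a,b]$; (B) $I(x,x+h)=\rho(x)h+o(h)$ as $h\to0$ for all $x\in[a,b]$. Then the function $x\mapsto I(a,x)$ satisfies the initial value problem $\frac{d}{dx}I(a,x)=\rho(x)$, $I(a,a)=0$ on the interval $(a,b)$. Consequently, for the given $\rho$ there is no more than one function $I:[a,b]\times[a,b]\to\mathbb{R}$ satisfying (A) and (B).
   Context: Axiom (B) means $\lim_{h\to0}\frac{I(x,x+h)-\rho(x)h}{h}=0$, where $h\neq 0$ ranges over those values with $x+h\in[a,b]$ (so the limit is one-sided at $x=a$ and $x=b$). That $I(a,x)$ satisfies the initial value problem on $(a,b)$ means that the differential equation holds at every $x\in(a,b)$ and that $I(a,a)=0$. *)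

theory Defs
  imports "HOL-Analysis.Analysis"
begin

text \<open>
  A function on \<open>[a,b] \<times> [a,b]\<close> is rendered as a total curried function
  \<open>I :: real \<Rightarrow> real \<Rightarrow> real\<close> whose values outside the square are irrelevant; two such functions
  are identified when they agree on the square.
\<close>

definition additivity_axiom :: "real \<Rightarrow> real \<Rightarrow> (real \<Rightarrow> real \<Rightarrow> real) \<Rightarrow> bool" where
  "additivity_axiom a b I \<longleftrightarrow>
     (\<forall>x\<in>{a..b}. \<forall>y\<in>{a..b}. \<forall>z\<in>{a..b}. I x y + I y z = I x z)"

text \<open>
  The increment \<open>h\<close> ranges over the nonzero values with \<open>x + h \<in> [a,b]\<close>, so the limit is one-sided
  at the two endpoints; the filter \<open>at 0 within _\<close> already excludes \<open>h = 0\<close>.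
\<close>

definition density_axiom ::
    "real \<Rightarrow> real \<Rightarrow> (real \<Rightarrow> real) \<Rightarrow> (real \<Rightarrow> real \<Rightarrow> real) \<Rightarrow> bool" where
  "density_axiom a b \<rho> I \<longleftrightarrow>
     (\<forall>x\<in>{a..b}.
        ((\<lambda>h. (I x (x + h) - \<rho> x * h) / h) \<longlongrightarrow> 0) (at 0 within {h. x + h \<in> {a..b}}))"

end

theory Submission
  imports Defs
begin

text \<open>
  By additivity \<open>I c (x + h) - I c x = I x (x + h)\<close>, so (B) is exactly differentiability of \<open>I c\<close>
  within the closed interval, endpoints included. For two solutions, \<open>I x - J x\<close> therefore has
  derivative zero and is constant on \<open>[a,b]\<close>; it vanishes at \<open>x\<close>, because \<open>I x x = 0 = J x x\<close>.
\<close>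

lemma additivity_axiom_diff:
  assumes "additivity_axiom a b I" "c \<in> {a..b}" "x \<in> {a..b}" "y \<in> {a..b}"
  shows "I x y = I c y - I c x"
proof -
  have "I c x + I x y = I c y"
    using assms unfolding additivity_axiom_def by blast
  then show ?thesis by simp
qed

text \<open>Substituting \<open>h = y - x\<close> turns the quotient in (B) into the difference
  quotient of \<open>I c\<close> minus \<open>\<rho> x\<close>. The base point \<open>c\<close> is
  kept arbitrary because the initial value problem uses \<open>c = a\<close>, while uniqueness bases
  both functions at the first argument.\<close>

lemma has_real_derivative_within_if_axioms:
  assumes A: "additivity_axiom a b I" and B: "density_axiom a b \<rho> I"
    and c: "c \<in> {a..b}" and x: "x \<in> {a..b}"
  shows "(I c has_real_derivative \<rho> x) (at x within {a..b})"
  unfolding has_field_derivative_iff Lim_within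
proof (intro allI impI)
  fix e :: real assume "e > 0"
  moreover have "((\<lambda>h. (I x (x + h) - \<rho> x * h) / h) \<longlongrightarrow> 0) (at 0 within {h. x + h \<in> {a..b}})"
    using B x unfolding density_axiom_def by blast
  ultimately obtain d where "d > 0" and d: "\<And>h. x + h \<in> {a..b} \<Longrightarrow> 0 < dist h 0 \<Longrightarrow> dist h 0 < d
      \<Longrightarrow> dist ((I x (x + h) - \<rho> x * h) / h) 0 < e"
    unfolding Lim_within by blast
  have "dist ((I c y - I c x) / (y - x)) (\<rho> x) < e"
    if y: "y \<in> {a..b}" and "0 < dist y x" "dist y x < d" for y
  proof -
    have "dist ((I x y - \<rho> x * (y - x)) / (y - x)) 0 < e"
      using d[of "y - x"] that by (simp add: dist_norm)
    \<comment> \<open>Additivity replaces \<open>I x y\<close> by \<open>I c y - I c x\<close>; the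
      term \<open>\<rho> x * (y - x) / (y - x)\<close> cancels since \<open>0 < dist y x\<close>
      forces \<open>y\<close> to differ from \<open>x\<close>.\<close>
    moreover have "(I x y - \<rho> x * (y - x)) / (y - x) = (I c y - I c x) / (y - x) - \<rho> x"
      using that additivity_axiom_diff[OF A c x y] by (simp add: diff_divide_distrib)
    ultimately show ?thesis by (simp add: dist_norm)
  qed
  with \<open>d > 0\<close> show "\<exists>d>0. \<forall>y\<in>{a..b}. 0 < dist y x \<and> dist y x < d \<longrightarrow>
      dist ((I c y - I c x) / (y - x)) (\<rho> x) < e"
    by blast
qed

lemma axioms_unique:
  assumes I: "additivity_axiom a b I" "density_axiom a b \<rho> I"
    and J: "additivity_axiom a b J" "density_axiom a b \<rho> J"
    and x: "x \<in> {a..b}" and y: "y \<in> {a..b}"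
  shows "I x y = J x y"
proof -
  have "((\<lambda>t. I x t - J x t) has_real_derivative 0) (at t within {a..b})" if "t \<in> {a..b}" for t
    using DERIV_diff[OF has_real_derivative_within_if_axioms[OF I x that]
        has_real_derivative_within_if_axioms[OF J x that]] by simp
  \<comment> \<open>The interval is convex, and the derivative is taken within it at the endpoints
    too, so constancy reaches \<open>a\<close> and \<open>b\<close> without a separate continuity
    argument.\<close>
  then obtain k where k: "\<And>t. t \<in> {a..b} \<Longrightarrow> I x t - J x t = k"
    using has_field_derivative_zero_constant[of "{a..b}" "\<lambda>t. I x t - J x t"] by auto
  \<comment> \<open>Evaluating at \<open>t = x\<close> identifies the constant:
    \<open>k = 0\<close>.\<close>
  have "I x x = 0" "J x x = 0"
    using additivity_axiom_diff[OF I(1) x x x] additivity_axiom_diff[OF J(1) x x x] by simp_all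
  then show ?thesis using k[OF x] k[OF y] by simp
qed

theorem lemma3p1:
  fixes a b :: real and \<rho> :: "real \<Rightarrow> real"
  assumes "a < b" and "continuous_on {a..b} \<rho>"
  shows "(\<forall>I. additivity_axiom a b I \<and> density_axiom a b \<rho> I \<longrightarrow>
            (\<forall>x\<in>{a<..<b}. ((\<lambda>x. I a x) has_real_derivative \<rho> x) (at x)) \<and> I a a = 0)
       \<and> (\<forall>I J. additivity_axiom a b I \<and> density_axiom a b \<rho> I \<and>
                additivity_axiom a b J \<and> density_axiom a b \<rho> J \<longrightarrow>
            (\<forall>x\<in>{a..b}. \<forall>y\<in>{a..b}. I x y = J x y))"
proof (intro conjI allI impI ballI; elim conjE)
  fix I x
  assume I: "additivity_axiom a b I" "density_axiom a b \<rho> I" and x: "x \<in> {a<..<b}"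
  have "(I a has_real_derivative \<rho> x) (at x within {a..b})"
    using x by (intro has_real_derivative_within_if_axioms[OF I]) auto
  \<comment> \<open>The closed interval is a neighbourhood of each interior point, so the restricted
    derivative is the ordinary one.\<close>
  moreover have "at x within {a..b} = at x"
    using x by (intro at_within_Icc_at) auto
  ultimately show "(I a has_real_derivative \<rho> x) (at x)"
    by simp
next
  fix I
  assume "additivity_axiom a b I"
  then show "I a a = 0"
    using additivity_axiom_diff[of a b I a a a] \<open>a < b\<close> by simp
next
  fix I J x y
  assume "additivity_axiom a b I" "density_axiom a b \<rho> I"
    "additivity_axiom a b J" "density_axiom a b \<rho> J" "x \<in> {a..b}" "y \<in> {a..b}"
  then show "I x y = J x y"
    by (rule axioms_unique)
qed

end
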